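(* Let $\varphi$ be a Ma-Minda function with $\varphi(z)=1+B_1z+B_2z^2+\cdots$, and let $f\in\mathcal{C}(\varphi)$. If $B_1\le|2B_1^2-B_2|$, then $$|T_{2,1}(f^{-1})|=|b_2^2-b_3^2|\le \frac{B_1^2}{4}+\frac{(2B_1^2-B_2)^2}{36}.$$ The estimate is sharp (for each such $\varphi$, equality is attained by some $f\in\mathcal{C}(\varphi)$).
   Context: $\mathbb{U}=\{z\in\mathbb{C}:|z|<1\}$, and $\mathcal{A}$ is the class of analytic functions $f$ on $\mathbb{U}$ of the form $f(z)=z+\sum_{n\ge2}a_nz^n$. For analytic $g,h$ on $\mathbb{U}$, $g\prec h$ (subordination) means there is an analytic $\omega:\mathbb{U}\to\mathbb{C}$ with $\omega(0)=0$, $|\omega(z)|\le1$, and $g=h\circ\omega$. A Ma-Minda function is an analytic univalent $\varphi$ on $\mathbb{U}$ with $\varphi(0)=1$, $\varphi'(0)>0$, mapping $\mathbb{U}$ onto a domain in the right half-plane that is symmetric about the real axis and starlike with respect to $\varphi(0)=1$ (so $B_1>0$ and all $B_n$ are real). $\mathcal{C}(\varphi)=\{f\in\mathcal{A}: 1+zf''(z)/f'(z)\prec\varphi(z)\}$; its members are univalent. The local inverse near $0$ is written $f^{-1}(w)=w+\sum_{n\ge2}b_nw^n$; thus $b_2=-a_2$, $b_3=-a_3+2a_2^2$. Definition: $T_{2,1}(f^{-1})=b_2^2-b_3^2$. *)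

theory Defs
  imports "HOL-Complex_Analysis.Complex_Analysis"
begin

abbreviation unit_disc :: "complex set"
  where "unit_disc \<equiv> ball 0 1"

abbreviation taylor_coeff :: "(complex \<Rightarrow> complex) \<Rightarrow> nat \<Rightarrow> complex"
  where "taylor_coeff f n \<equiv> fps_nth (fps_expansion f 0) n"

definition class_A :: "(complex \<Rightarrow> complex) set"
  where "class_A = {f. f holomorphic_on unit_disc \<and> f 0 = 0 \<and> deriv f 0 = 1}"

(* Only norm (w z) \<le> 1 is demanded; as w 0 = 0, the maximum principle gives norm (w z) < 1,
   so values of h outside the open disc are never used. *)
definition subordinate :: "(complex \<Rightarrow> complex) \<Rightarrow> (complex \<Rightarrow> complex) \<Rightarrow> bool"
  where "subordinate g h \<longleftrightarrow>
    g holomorphic_on unit_disc \<and> h holomorphic_on unit_disc \<and>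
    (\<exists>w. w holomorphic_on unit_disc \<and> w 0 = 0 \<and>
         (\<forall>z\<in>unit_disc. norm (w z) \<le> 1 \<and> g z = h (w z)))"

(* The image is automatically a domain (open mapping theorem).  The library's starlike leaves
   the centre existentially quantified, so starlikeness with respect to 1 is spelled out. *)
definition ma_minda :: "(complex \<Rightarrow> complex) \<Rightarrow> bool"
  where "ma_minda \<phi> \<longleftrightarrow>
    \<phi> holomorphic_on unit_disc \<and> inj_on \<phi> unit_disc \<and>
    \<phi> 0 = 1 \<and> deriv \<phi> 0 \<in> \<real> \<and> Re (deriv \<phi> 0) > 0 \<and>
    (\<forall>z\<in>unit_disc. Re (\<phi> z) > 0) \<and>
    cnj ` (\<phi> ` unit_disc) = \<phi> ` unit_disc \<and>
    (\<forall>w\<in>\<phi> ` unit_disc. closed_segment 1 w \<subseteq> \<phi> ` unit_disc)"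

(* The real number B_n in \<phi>(z) = 1 + B_1 z + B_2 z^2 + ...: the Taylor coefficients of a
   Ma-Minda function are real by the symmetry of its image, so Re only changes the type. *)
definition mm_coeff :: "(complex \<Rightarrow> complex) \<Rightarrow> nat \<Rightarrow> real"
  where "mm_coeff \<phi> n = Re (taylor_coeff \<phi> n)"

(* The condition deriv f z \<noteq> 0 makes the quotient meaningful, since x / 0 = 0 in HOL. *)
definition convex_class :: "(complex \<Rightarrow> complex) \<Rightarrow> (complex \<Rightarrow> complex) set"
  where "convex_class \<phi> = {f \<in> class_A.
    (\<forall>z\<in>unit_disc. deriv f z \<noteq> 0) \<and>
    subordinate (\<lambda>z. 1 + z * deriv (deriv f) z / deriv f z) \<phi>}"

definition is_local_inverse :: "(complex \<Rightarrow> complex) \<Rightarrow> (complex \<Rightarrow> complex) \<Rightarrow> bool"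
  where "is_local_inverse f g \<longleftrightarrow>
    (\<exists>r>0. g holomorphic_on ball 0 r \<and> g 0 = 0 \<and>
           (\<forall>w\<in>ball 0 r. g w \<in> unit_disc \<and> f (g w) = w))"

(* For f in class_A a local inverse exists because deriv f 0 = 1, and any two of them agree
   near 0, so the Taylor coefficients at 0 do not depend on the choice made by SOME. *)
definition local_inverse :: "(complex \<Rightarrow> complex) \<Rightarrow> complex \<Rightarrow> complex"
  where "local_inverse f = (SOME g. is_local_inverse f g)"

definition T21 :: "(complex \<Rightarrow> complex) \<Rightarrow> complex"
  where "T21 g = (taylor_coeff g 2)\<^sup>2 - (taylor_coeff g 3)\<^sup>2"

end

theory Submission
  imports Defs
begin

text \<open>
  If \<open>1 + z f'' / f' = \<phi> \<circ> w\<close> with \<open>w z = c\<^sub>1 z + c\<^sub>2 z\<^sup>2 + \<dots>\<close>, comparing coefficients gives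
  \<open>b\<^sub>2 = - B\<^sub>1 c\<^sub>1 / 2\<close> and \<open>b\<^sub>3 = ((2 B\<^sub>1\<^sup>2 - B\<^sub>2) c\<^sub>1\<^sup>2 - B\<^sub>1 c\<^sub>2) / 6\<close>. The Schwarz--Pick inequality
  \<open>\<bar>c\<^sub>2\<bar> \<le> 1 - \<bar>c\<^sub>1\<bar>\<^sup>2\<close> and \<open>B\<^sub>1 \<le> \<bar>2 B\<^sub>1\<^sup>2 - B\<^sub>2\<bar>\<close> then bound \<open>\<bar>b\<^sub>2\<bar>\<close> and \<open>\<bar>b\<^sub>3\<bar>\<close> separately, and
  \<open>w z = \<i> z\<close> attains both bounds while making \<open>b\<^sub>2\<^sup>2\<close> and \<open>- b\<^sub>3\<^sup>2\<close> both nonpositive.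
\<close>

section \<open>Taylor coefficients at 0 and bounds of Schwarz type\<close>

lemma has_fps_expansion_disc:
  "f holomorphic_on unit_disc \<Longrightarrow> f has_fps_expansion fps_expansion f 0"
  by (rule has_fps_expansion_fps_expansion[of unit_disc]) auto

lemma taylor_coeff_0: "taylor_coeff f 0 = f 0"
  by (simp add: fps_expansion_def)

lemma taylor_coeff_1: "taylor_coeff f (Suc 0) = deriv f 0"
  by (simp add: fps_expansion_def)

text \<open>A point of the disc with value of modulus 1 would be an interior maximum, so
  \<open>w\<close> would be constant, against \<open>norm (w 0) < 1\<close>. The strict bound is
  what the Schwarz lemma asks for, while subordination only supplies the weak one.\<close>

lemma self_map_norm_less_1:
  assumes "w holomorphic_on unit_disc" "\<And>z. z \<in> unit_disc \<Longrightarrow> norm (w z) \<le> 1"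
    and "norm (w 0) < 1" "z \<in> unit_disc"
  shows "norm (w z) < 1"
proof (rule ccontr)
  assume "\<not> norm (w z) < 1"
  with assms(2)[OF assms(4)] have z: "norm (w z) = 1" by simp
  have "w constant_on unit_disc"
    by (rule maximum_modulus_principle[OF assms(1), of unit_disc z]) (use assms z in auto)
  then have "w 0 = w z"
    using assms(4) by (auto simp: constant_on_def)
  with z assms(3) show False by simp
qed

text \<open>Following \<open>h\<close> by the disc automorphism that sends \<open>h 0\<close> to 0
  reduces the claim to the derivative bound of the Schwarz lemma.\<close>

lemma Schwarz_Pick_at_0:
  assumes holo: "h holomorphic_on unit_disc" and le: "\<And>z. z \<in> unit_disc \<Longrightarrow> norm (h z) \<le> 1"
  shows "norm (deriv h 0) \<le> 1 - (norm (h 0))\<^sup>2"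
proof (cases "norm (h 0) < 1")
  \<comment> \<open>Here the modulus attains its maximum at the centre, so \<open>h\<close> is
    constant and both sides of the inequality are 0.\<close>
  case False
  then have "norm (h 0) = 1" using le[of 0] by auto
  moreover have "h constant_on unit_disc"
    by (rule maximum_modulus_principle[OF holo, of unit_disc 0]) (use False le in force)+
  then obtain c where c: "\<And>z. z \<in> unit_disc \<Longrightarrow> h z = c" by (auto simp: constant_on_def)
  have "deriv h 0 = deriv (\<lambda>_. c) 0"
    by (intro deriv_cong_ev eventually_mono[OF eventually_nhds_in_open[of unit_disc]] c) auto
  ultimately show ?thesis by simp
next
  case True
  define a where "a = h 0"
  define m where "m = Moebius_function 0 a \<circ> h"
  have a: "norm a < 1" using True by (simp add: a_def)
  have lt: "norm (h z) < 1" if "z \<in> unit_disc" for z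
    using self_map_norm_less_1[OF holo le True that] by simp
  have m_holo: "m holomorphic_on unit_disc"
    unfolding m_def using lt
    by (intro holomorphic_on_compose_gen[OF holo Moebius_function_holomorphic[OF a]]) auto
  have m0: "m 0 = 0"
    by (simp add: m_def a_def Moebius_function_eq_zero)
  have m1: "norm (deriv m 0) \<le> 1"
    by (rule Schwarz_Lemma(2)[OF m_holo m0, of 0])
       (use lt a in \<open>auto simp: m_def intro!: Moebius_function_norm_lt_1\<close>)
  \<comment> \<open>Clearing the denominator allows differentiation by the product rule; at 0 the
    term containing \<open>deriv h 0\<close> on the left drops out because
    \<open>m 0 = 0\<close>.\<close>
  have m_eq: "m z * (1 - cnj a * h z) = h z - a" if "z \<in> unit_disc" for z
  proof -
    have "norm (cnj a * h z) < 1"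
      using norm_mult_less[of "cnj a" 1 "h z" 1] a lt[OF that] by simp
    then have "1 - cnj a * h z \<noteq> 0" by auto
    then show ?thesis by (simp add: m_def Moebius_function_simple)
  qed
  have dh: "(h has_field_derivative deriv h 0) (at 0)"
    using holo by (simp add: holomorphic_derivI[of _ unit_disc])
  have dm: "(m has_field_derivative deriv m 0) (at 0)"
    using m_holo by (simp add: holomorphic_derivI[of _ unit_disc])
  have "((\<lambda>z. m z * (1 - cnj a * h z)) has_field_derivative deriv m 0 * (1 - cnj a * a)) (at 0)"
    by (rule derivative_eq_intros dh dm refl)+ (simp add: m0 a_def)
  moreover have "((\<lambda>z. m z * (1 - cnj a * h z)) has_field_derivative deriv h 0) (at 0)"
  proof (rule has_field_derivative_transform_within_open[of _ _ _ unit_disc])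
    show "((\<lambda>z. h z - a) has_field_derivative deriv h 0) (at 0)"
      by (rule derivative_eq_intros dh refl)+ simp
  qed (use m_eq in auto)
  ultimately have "deriv h 0 = deriv m 0 * (1 - cnj a * a)"
    by (rule DERIV_unique[symmetric])
  also have "1 - cnj a * a = of_real (1 - (norm a)\<^sup>2)"
    by (metis complex_norm_square mult.commute of_real_1 of_real_diff)
  finally have "norm (deriv h 0) = norm (deriv m 0) * \<bar>1 - (norm a)\<^sup>2\<bar>"
    by (simp add: norm_mult del: of_real_diff)
  also have "\<bar>1 - (norm a)\<^sup>2\<bar> = 1 - (norm a)\<^sup>2"
    using a by (simp add: power_le_one)
  also have "norm (deriv m 0) * (1 - (norm a)\<^sup>2) \<le> 1 * (1 - (norm a)\<^sup>2)"
    using a m1 by (intro mult_right_mono) (auto simp: power_le_one)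
  finally show ?thesis by (simp add: a_def)
qed

text \<open>The quotient \<open>h z = w z / z\<close>, extended to 0, is again bounded by 1, and its
  value and derivative at 0 are the first two coefficients of \<open>w\<close>. The second bound is
  therefore Schwarz-Pick for \<open>h\<close>.\<close>

lemma Schwarz_coeff_bounds:
  assumes holo: "w holomorphic_on unit_disc" and w0: "w 0 = 0"
    and le: "\<And>z. z \<in> unit_disc \<Longrightarrow> norm (w z) \<le> 1"
  shows "norm (taylor_coeff w 1) \<le> 1"
    and "norm (taylor_coeff w 2) \<le> 1 - (norm (taylor_coeff w 1))\<^sup>2"
proof -
  have lt: "norm (w z) < 1" if "norm z < 1" for z
    using self_map_norm_less_1[OF holo le _, of z] w0 that by simp
  show "norm (taylor_coeff w 1) \<le> 1"
    using Schwarz_Lemma(2)[OF holo w0 lt, of 0] by (simp add: taylor_coeff_1)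
  obtain h where h: "h holomorphic_on unit_disc" "\<And>z. norm z < 1 \<Longrightarrow> w z = z * h z"
    "deriv w 0 = h 0"
    using Schwarz3[OF holo w0] by blast
  have h_le: "norm (h z) \<le> 1" if "z \<in> unit_disc" for z
  proof (cases "z = 0")
    case True
    then show ?thesis
      using Schwarz_Lemma(2)[OF holo w0 lt, of 0] h(3) by simp
  next
    case False
    then show ?thesis
      using Schwarz_Lemma(1)[OF holo w0 lt, of z] h(2)[of z] that by (simp add: norm_mult)
  qed
  have "(\<lambda>z. z * h z) has_fps_expansion fps_X * fps_expansion h 0"
    by (intro fps_expansion_intros has_fps_expansion_disc h)
  also have "?this \<longleftrightarrow> w has_fps_expansion fps_X * fps_expansion h 0"
    using h(2) by (intro has_fps_expansion_cong eventually_mono[OF eventually_nhds_in_open[of unit_disc]]) auto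
  finally have "fps_expansion w 0 = fps_X * fps_expansion h 0"
    by (rule fps_expansion_eqI)
  then have "taylor_coeff w 2 = deriv h 0"
    by (simp add: numeral_2_eq_2 taylor_coeff_1)
  then show "norm (taylor_coeff w 2) \<le> 1 - (norm (taylor_coeff w 1))\<^sup>2"
    using Schwarz_Pick_at_0[OF h(1) h_le] h(3) by (simp add: taylor_coeff_1)
qed

section \<open>Reality of the coefficients of a Ma-Minda function\<close>

text \<open>Conjugate termwise the Taylor series of \<open>f\<close> at \<open>cnj u\<close>. This
  yields both the derivative of the reflected function at 0 and, once the reflection is known to be
  \<open>\<phi>\<close> itself, the reality of all coefficients.\<close>

lemma fps_expansion_cnj:
  assumes "f holomorphic_on unit_disc"
  shows "(cnj \<circ> f \<circ> cnj) has_fps_expansion Abs_fps (\<lambda>n. cnj (taylor_coeff f n))"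
proof (rule has_fps_expansionI, rule eventually_mono[OF eventually_nhds_in_open[of unit_disc]])
  fix u :: complex
  assume "u \<in> unit_disc"
  then have "(\<lambda>n. taylor_coeff f n * cnj u ^ n) sums f (cnj u)"
    using holomorphic_power_series[OF assms, of "cnj u"] by (simp add: fps_expansion_def)
  then have "(\<lambda>n. cnj (taylor_coeff f n * cnj u ^ n)) sums cnj (f (cnj u))"
    by (simp only: sums_cnj)
  then show "(\<lambda>n. fps_nth (Abs_fps (\<lambda>n. cnj (taylor_coeff f n))) n * u ^ n) sums (cnj \<circ> f \<circ> cnj) u"
    by simp
qed auto

text \<open>By the Schwarz lemma, \<open>\<phi>\<close> is the only Riemann map of its image with the given value and
  positive derivative at 0, and reflecting it yields another one.\<close>

lemma ma_minda_reflection: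
  assumes "ma_minda \<phi>" "z \<in> unit_disc"
  shows "cnj (\<phi> (cnj z)) = \<phi> z"
proof -
  have holo: "\<phi> holomorphic_on unit_disc" and inj: "inj_on \<phi> unit_disc" and \<phi>0: "\<phi> 0 = 1"
    and real: "deriv \<phi> 0 \<in> \<real>" and pos: "Re (deriv \<phi> 0) > 0"
    and sym: "cnj ` (\<phi> ` unit_disc) = \<phi> ` unit_disc"
    using assms by (auto simp: ma_minda_def)
  define \<psi> where "\<psi> = cnj \<circ> \<phi> \<circ> cnj"
  have cnj_disc: "cnj ` unit_disc = unit_disc"
    by (auto simp: image_iff intro!: bexI[of _ "cnj x" for x])
  have \<psi>_holo: "\<psi> holomorphic_on unit_disc"
    unfolding \<psi>_def by (rule holomorphic_on_compose_cnj_cnj) (use holo cnj_disc in auto)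
  have "deriv \<psi> 0 = cnj (deriv \<phi> 0)"
    using arg_cong[OF fps_expansion_eqI[OF fps_expansion_cnj[OF holo]], of "\<lambda>F. fps_nth F 1"]
    by (simp add: \<psi>_def taylor_coeff_1)
  then have d\<psi>: "deriv \<psi> 0 = deriv \<phi> 0"
    using real by (simp add: Reals_cnj_iff)
  obtain G where G: "G holomorphic_on \<phi> ` unit_disc" "\<And>z. z \<in> unit_disc \<Longrightarrow> G (\<phi> z) = z"
    using holomorphic_has_inverse[OF holo open_ball inj] by metis
  have \<psi>_img: "\<psi> z \<in> \<phi> ` unit_disc" if "z \<in> unit_disc" for z
  proof -
    have "cnj z \<in> unit_disc" using that by simp
    then have "\<psi> z \<in> cnj ` \<phi> ` unit_disc" by (auto simp: \<psi>_def)
    then show ?thesis by (simp only: sym)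
  qed
  \<comment> \<open>As \<open>\<psi>\<close> takes its values in the image of \<open>\<phi>\<close>,
    this is a holomorphic self-map of the disc that fixes 0 and satisfies
    \<open>\<phi> (h z) = \<psi> z\<close> there. The goal becomes that \<open>h\<close> is the
    identity.\<close>
  define h where "h = G \<circ> \<psi>"
  have h_holo: "h holomorphic_on unit_disc"
    unfolding h_def using \<psi>_img by (intro holomorphic_on_compose_gen[OF \<psi>_holo G(1)]) auto
  have h_disc: "norm (h z) < 1" and \<phi>h: "\<phi> (h z) = \<psi> z" if z: "norm z < 1" for z
  proof -
    obtain u where "u \<in> unit_disc" "\<psi> z = \<phi> u"
      using \<psi>_img[of z] z by auto
    then show "norm (h z) < 1" "\<phi> (h z) = \<psi> z"
      using G(2)[of u] by (auto simp: h_def)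
  qed
  have h0: "h 0 = 0"
    using G(2)[of 0] \<phi>0 by (simp add: h_def \<psi>_def)
  have dh: "(h has_field_derivative deriv h 0) (at 0)"
    using h_holo by (simp add: holomorphic_derivI[of _ unit_disc])
  have d\<phi>: "(\<phi> has_field_derivative deriv \<phi> 0) (at (h 0))"
    using holo h0 by (simp add: holomorphic_derivI[of _ unit_disc])
  have "(\<phi> \<circ> h has_field_derivative deriv \<phi> 0 * deriv h 0) (at 0)"
    by (rule DERIV_chain[OF d\<phi> dh])
  then have "(\<psi> has_field_derivative deriv \<phi> 0 * deriv h 0) (at 0)"
    by (rule has_field_derivative_transform_within_open[of _ _ _ unit_disc]) (use \<phi>h in auto)
  then have "deriv \<phi> 0 * deriv h 0 = deriv \<phi> 0"
    using d\<psi> by (simp add: DERIV_imp_deriv)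
  \<comment> \<open>This is the equality case of the Schwarz lemma: \<open>h\<close> is
    multiplication by a constant, which its derivative at 0 then identifies as 1.\<close>
  then have dh1: "deriv h 0 = 1"
    using pos by auto
  then obtain \<alpha> where \<alpha>: "\<And>z. norm z < 1 \<Longrightarrow> h z = \<alpha> * z"
    using Schwarz_Lemma(3)[OF h_holo h0 h_disc, of 0] by auto
  have "((\<lambda>z. \<alpha> * z) has_field_derivative deriv h 0) (at 0)"
    by (rule has_field_derivative_transform_within_open[OF dh, of unit_disc]) (use \<alpha> in auto)
  moreover have "((\<lambda>z. \<alpha> * z) has_field_derivative \<alpha>) (at 0)"
    by (auto intro!: derivative_eq_intros)
  ultimately have "\<alpha> = 1"
    using dh1 DERIV_unique by metis
  then show ?thesis
    using \<alpha>[of z] \<phi>h[of z] assms(2) by (simp add: \<psi>_def)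
qed

text \<open>By the reflection identity the conjugated series also expands \<open>\<phi>\<close>, so
  uniqueness of expansions makes every coefficient equal to its conjugate.\<close>

lemma ma_minda_taylor_coeff:
  assumes "ma_minda \<phi>"
  shows "taylor_coeff \<phi> n = of_real (mm_coeff \<phi> n)"
proof -
  have holo: "\<phi> holomorphic_on unit_disc"
    using assms by (simp add: ma_minda_def)
  have "(cnj \<circ> \<phi> \<circ> cnj) has_fps_expansion Abs_fps (\<lambda>n. cnj (taylor_coeff \<phi> n))"
    by (rule fps_expansion_cnj[OF holo])
  also have "?this \<longleftrightarrow> \<phi> has_fps_expansion Abs_fps (\<lambda>n. cnj (taylor_coeff \<phi> n))"
    using ma_minda_reflection[OF assms]
    by (intro has_fps_expansion_cong eventually_mono[OF eventually_nhds_in_open[of unit_disc]]) auto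
  finally have "taylor_coeff \<phi> n = cnj (taylor_coeff \<phi> n)"
    using fps_expansion_eqI[of \<phi>] by (metis fps_nth_Abs_fps)
  then show ?thesis
    by (simp add: mm_coeff_def complex_eq_iff)
qed

section \<open>Coefficients of the local inverse\<close>

text \<open>A nonzero derivative at 0 makes \<open>f\<close> injective with open image on a small
  ball, which provides the witness that \<open>SOME\<close> requires.\<close>

lemma local_inverse_is_local_inverse:
  assumes "f \<in> class_A"
  shows "is_local_inverse f (local_inverse f)"
  unfolding local_inverse_def
proof (rule someI_ex[of "is_local_inverse f"])
  have holo: "f holomorphic_on unit_disc" and f0: "f 0 = 0" and f1: "deriv f 0 = 1"
    using assms by (auto simp: class_A_def)
  obtain r where r: "r > 0" "ball 0 r \<subseteq> unit_disc" "open (f ` ball 0 r)" "inj_on f (ball 0 r)"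
    using has_complex_derivative_locally_invertible[OF holo, of 0] f1 by auto
  obtain g where g: "g holomorphic_on f ` ball 0 r" "\<And>z. z \<in> ball 0 r \<Longrightarrow> g (f z) = z"
    using holomorphic_has_inverse[OF holomorphic_on_subset[OF holo r(2)] open_ball r(4)] by metis
  have "0 \<in> f ` ball 0 r"
    using f0 r(1) by (metis centre_in_ball imageI)
  then obtain s where s: "s > 0" "ball 0 s \<subseteq> f ` ball 0 r"
    using r(3) open_contains_ball by blast
  have "g holomorphic_on ball 0 s"
    using g(1) s(2) holomorphic_on_subset by blast
  moreover have "g 0 = 0"
    using g(2)[of 0] f0 r(1) by simp
  moreover have "g w \<in> unit_disc \<and> f (g w) = w" if w: "w \<in> ball 0 s" for w
  proof -
    obtain z where "z \<in> ball 0 r" "w = f z" using w s(2) by blast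
    then show ?thesis using g(2)[of z] r(2) by auto
  qed
  ultimately show "\<exists>g. is_local_inverse f g"
    unfolding is_local_inverse_def using s(1) by blast
qed

text \<open>Comparing coefficients in \<open>F oo G = fps_X\<close> gives a triangular system:
  \<open>G_1 = 1\<close>, then \<open>G_2 + F_2 = 0\<close>, then
  \<open>G_3 + 2 F_2 G_2 + F_3 = 0\<close>.\<close>

lemma fps_compose_inverse_nth:
  fixes F G :: "'a :: comm_ring_1 fps"
  assumes "F oo G = fps_X" "fps_nth F 1 = 1" "fps_nth G 0 = 0"
  shows "fps_nth G 2 = - fps_nth F 2"
    and "fps_nth G 3 = 2 * (fps_nth F 2)\<^sup>2 - fps_nth F 3"
proof -
  have eq: "(\<Sum>i=0..n. fps_nth F i * fps_nth (G ^ i) n) = (if n = 1 then 1 else 0)" for n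
    using arg_cong[OF assms(1), of "\<lambda>H. fps_nth H n"] by (simp add: fps_compose_nth)
  have 1: "fps_nth G (Suc 0) = 1"
    using eq[of 1] assms by simp
  show 2: "fps_nth G 2 = - fps_nth F 2"
    using eq[of 2] assms 1
    by (simp add: numeral_2_eq_2 fps_mult_nth eq_neg_iff_add_eq_0)
  show "fps_nth G 3 = 2 * (fps_nth F 2)\<^sup>2 - fps_nth F 3"
    using eq[of 3] assms 1 2
    by (simp add: numeral_2_eq_2 numeral_3_eq_3 fps_mult_nth algebra_simps)
qed

text \<open>Since \<open>g 0 = 0\<close>, the identity \<open>f (g w) = w\<close> near 0 passes to
  formal composition of the two expansions.\<close>

lemma taylor_coeff_local_inverse:
  assumes "f \<in> class_A"
  shows "taylor_coeff (local_inverse f) 2 = - taylor_coeff f 2"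
    and "taylor_coeff (local_inverse f) 3 = 2 * (taylor_coeff f 2)\<^sup>2 - taylor_coeff f 3"
proof -
  define g where "g = local_inverse f"
  have holo: "f holomorphic_on unit_disc" and f1: "deriv f 0 = 1"
    using assms by (auto simp: class_A_def)
  obtain r where r: "r > 0" "g holomorphic_on ball 0 r" "g 0 = 0" "\<And>w. w \<in> ball 0 r \<Longrightarrow> f (g w) = w"
    using local_inverse_is_local_inverse[OF assms] by (auto simp: is_local_inverse_def g_def)
  have "g has_fps_expansion fps_expansion g 0"
    by (rule has_fps_expansion_fps_expansion[OF _ _ r(2)]) (use r(1) in auto)
  then have "(f \<circ> g) has_fps_expansion (fps_expansion f 0 oo fps_expansion g 0)"
    using r(3) by (intro has_fps_expansion_compose has_fps_expansion_disc[OF holo])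
      (simp_all add: taylor_coeff_0)
  also have "?this \<longleftrightarrow> (\<lambda>w. w) has_fps_expansion (fps_expansion f 0 oo fps_expansion g 0)"
    using r(1,4)
    by (intro has_fps_expansion_cong eventually_mono[OF eventually_nhds_in_open[of "ball 0 r"]]) auto
  finally have comp: "fps_expansion f 0 oo fps_expansion g 0 = fps_X"
    using fps_expansion_unique_complex has_fps_expansion_fps_X by blast
  show "taylor_coeff (local_inverse f) 2 = - taylor_coeff f 2"
    "taylor_coeff (local_inverse f) 3 = 2 * (taylor_coeff f 2)\<^sup>2 - taylor_coeff f 3"
    using fps_compose_inverse_nth[OF comp] f1 r(3) by (simp_all add: taylor_coeff_0 taylor_coeff_1 g_def)
qed

section \<open>Coefficients of functions in the convex class\<close>

text \<open>Multiplying by \<open>deriv f z\<close> gives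
  \<open>f' + z f'' = f' (\<phi> \<circ> w)\<close>, an identity of power series whose terms of
  degree 1 and 2 yield the two formulas.\<close>

lemma convex_class_taylor_coeffs:
  assumes f: "f \<in> class_A" "\<forall>z\<in>unit_disc. deriv f z \<noteq> 0"
    and \<phi>: "\<phi> holomorphic_on unit_disc" "\<phi> 0 = 1"
    and w: "w holomorphic_on unit_disc" "w 0 = 0"
    and eq: "\<forall>z\<in>unit_disc. 1 + z * deriv (deriv f) z / deriv f z = \<phi> (w z)"
  shows "2 * taylor_coeff f 2 = taylor_coeff \<phi> 1 * taylor_coeff w 1"
    and "6 * taylor_coeff f 3 = taylor_coeff \<phi> 1 * taylor_coeff w 2
           + (taylor_coeff \<phi> 2 + (taylor_coeff \<phi> 1)\<^sup>2) * (taylor_coeff w 1)\<^sup>2"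
proof -
  have holo: "f holomorphic_on unit_disc" and f1: "deriv f 0 = 1"
    using f by (auto simp: class_A_def)
  let ?F = "fps_expansion f 0" and ?\<Phi> = "fps_expansion \<phi> 0" and ?W = "fps_expansion w 0"
  have F: "f has_fps_expansion ?F" by (rule has_fps_expansion_disc[OF holo])
  have F1: "fps_nth ?F (Suc 0) = 1" by (simp add: taylor_coeff_1 f1)
  have W0: "fps_nth ?W 0 = 0" by (simp add: taylor_coeff_0 w)
  have \<Phi>0: "fps_nth ?\<Phi> 0 = 1" by (simp add: taylor_coeff_0 \<phi>)
  have "(\<lambda>z. deriv f z + z * deriv (deriv f) z) has_fps_expansion
          fps_deriv ?F + fps_X * fps_deriv (fps_deriv ?F)"
    by (intro fps_expansion_intros F)
  also have "?this \<longleftrightarrow> (\<lambda>z. deriv f z * (\<phi> \<circ> w) z) has_fps_expansion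
          fps_deriv ?F + fps_X * fps_deriv (fps_deriv ?F)"
  proof (intro has_fps_expansion_cong eventually_mono[OF eventually_nhds_in_open[of unit_disc]])
    fix z :: complex assume z: "z \<in> unit_disc"
    have "deriv f z * \<phi> (w z) = deriv f z * (1 + z * deriv (deriv f) z / deriv f z)"
      using eq z by simp
    also have "\<dots> = deriv f z + z * deriv (deriv f) z"
      using f(2) z by (simp add: field_simps)
    finally show "deriv f z + z * deriv (deriv f) z = deriv f z * (\<phi> \<circ> w) z" by simp
  qed auto
  finally have 1: "(\<lambda>z. deriv f z * (\<phi> \<circ> w) z) has_fps_expansion
          fps_deriv ?F + fps_X * fps_deriv (fps_deriv ?F)" .
  have 2: "(\<lambda>z. deriv f z * (\<phi> \<circ> w) z) has_fps_expansion fps_deriv ?F * (?\<Phi> oo ?W)"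
    by (intro fps_expansion_intros F has_fps_expansion_disc w \<phi> W0)
  have fps_eq: "fps_nth (fps_deriv ?F + fps_X * fps_deriv (fps_deriv ?F)) n
      = fps_nth (fps_deriv ?F * (?\<Phi> oo ?W)) n" for n
    using fps_expansion_unique_complex[OF 1 2] by simp
  \<comment> \<open>The left side has coefficient \<open>(n+1)^2 a_(n+1)\<close> in degree
    \<open>n\<close>, so degree 1 reads \<open>4 a_2 = 2 a_2 + B_1 c_1\<close>.\<close>
  show a2: "2 * taylor_coeff f 2 = taylor_coeff \<phi> 1 * taylor_coeff w 1"
    using fps_eq[of 1] by (simp add: fps_mult_nth fps_compose_nth F1 W0 \<Phi>0 numeral_2_eq_2)
  \<comment> \<open>Degree 2 reads
    \<open>9 a_3 = 3 a_3 + 2 a_2 B_1 c_1 + B_1 c_2 + B_2 c_1^2\<close>; replacing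
    \<open>2 a_2\<close> by \<open>B_1 c_1\<close> afterwards produces the square of
    \<open>B_1\<close>.\<close>
  have "6 * taylor_coeff f 3 = taylor_coeff \<phi> 1 * taylor_coeff w 2
           + taylor_coeff \<phi> 2 * (taylor_coeff w 1)\<^sup>2
           + 2 * taylor_coeff f 2 * (taylor_coeff \<phi> 1 * taylor_coeff w 1)"
    using fps_eq[of 2]
    by (simp add: fps_mult_nth fps_compose_nth F1 W0 \<Phi>0 numeral_2_eq_2 numeral_3_eq_3 algebra_simps)
  then show "6 * taylor_coeff f 3 = taylor_coeff \<phi> 1 * taylor_coeff w 2
           + (taylor_coeff \<phi> 2 + (taylor_coeff \<phi> 1)\<^sup>2) * (taylor_coeff w 1)\<^sup>2"
    unfolding a2 by (simp add: algebra_simps power2_eq_square)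
qed

text \<open>In \<open>6 b_3 = 12 a_2^2 - 6 a_3\<close> the first term contributes
  \<open>3 B_1^2 c_1^2\<close> and the second takes away \<open>B_1^2 c_1^2\<close>, whence the
  factor \<open>2 B_1^2\<close>. With \<open>f\<close> and \<open>w\<close> given explicitly, the
  formulas serve both the upper bound and the extremal function.\<close>

lemma taylor_coeff_local_inverse_convex_class:
  assumes \<phi>: "ma_minda \<phi>"
    and f: "f \<in> class_A" "\<forall>z\<in>unit_disc. deriv f z \<noteq> 0"
    and w: "w holomorphic_on unit_disc" "w 0 = 0"
    and eq: "\<forall>z\<in>unit_disc. 1 + z * deriv (deriv f) z / deriv f z = \<phi> (w z)"
  defines "B\<^sub>1 \<equiv> mm_coeff \<phi> 1" and "B\<^sub>2 \<equiv> mm_coeff \<phi> 2"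
  shows "taylor_coeff (local_inverse f) 2 = - (of_real B\<^sub>1 * taylor_coeff w 1 / 2)"
    and "taylor_coeff (local_inverse f) 3
      = (of_real (2 * B\<^sub>1\<^sup>2 - B\<^sub>2) * (taylor_coeff w 1)\<^sup>2 - of_real B\<^sub>1 * taylor_coeff w 2) / 6"
proof -
  have \<phi>': "\<phi> holomorphic_on unit_disc" "\<phi> 0 = 1"
    using \<phi> by (auto simp: ma_minda_def)
  note a = convex_class_taylor_coeffs[OF f \<phi>' w eq, unfolded ma_minda_taylor_coeff[OF \<phi>],
      folded B\<^sub>1_def B\<^sub>2_def]
  have a2: "taylor_coeff f 2 = of_real B\<^sub>1 * taylor_coeff w 1 / 2"
    using a(1) by (simp add: field_simps)
  have a3: "taylor_coeff f 3
      = (of_real B\<^sub>1 * taylor_coeff w 2 + (of_real B\<^sub>2 + (of_real B\<^sub>1)\<^sup>2) * (taylor_coeff w 1)\<^sup>2) / 6"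
    using a(2) by (simp add: field_simps)
  show "taylor_coeff (local_inverse f) 2 = - (of_real B\<^sub>1 * taylor_coeff w 1 / 2)"
    by (simp add: taylor_coeff_local_inverse[OF f(1)] a2)
  show "taylor_coeff (local_inverse f) 3
      = (of_real (2 * B\<^sub>1\<^sup>2 - B\<^sub>2) * (taylor_coeff w 1)\<^sup>2 - of_real B\<^sub>1 * taylor_coeff w 2) / 6"
    by (simp add: taylor_coeff_local_inverse[OF f(1)] a2 a3 field_simps power2_eq_square)
qed

section \<open>Existence of a function with prescribed convexity quotient\<close>

text \<open>The equation is \<open>f'' / f' = (p - 1) / z\<close>, whose right side extends
  holomorphically to 0 because \<open>p 0 = 1\<close>. Integrating, exponentiating and integrating
  again solves it on the disc. This supplies the function for which equality holds.\<close>

lemma class_A_with_convexity_quotient: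
  assumes p: "p holomorphic_on unit_disc" "p 0 = 1"
  obtains f where "f \<in> class_A" "\<And>z. z \<in> unit_disc \<Longrightarrow> deriv f z \<noteq> 0"
    "\<And>z. z \<in> unit_disc \<Longrightarrow> 1 + z * deriv (deriv f) z / deriv f z = p z"
proof -
  have "(\<lambda>z. p z - 1) holomorphic_on unit_disc"
    by (intro holomorphic_intros p)
  then obtain q where q: "q holomorphic_on unit_disc" "\<And>z. norm z < 1 \<Longrightarrow> p z - 1 = z * q z"
    using Schwarz3[of "\<lambda>z. p z - 1" 1] p(2) by auto
  obtain Q where Q: "\<And>z. z \<in> unit_disc \<Longrightarrow> (Q has_field_derivative q z) (at z within unit_disc)"
    using holomorphic_convex_primitive'[OF convex_ball open_ball q(1)] by blast
  then have Q': "(Q has_field_derivative q z) (at z)" if "z \<in> unit_disc" for z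
    using that by (metis at_within_open open_ball)
  \<comment> \<open>The future derivative of \<open>f\<close>: the exponential never vanishes, and
    subtracting \<open>Q 0\<close> normalises its value at 0 to 1.\<close>
  define e where "e = (\<lambda>z. exp (Q z - Q 0))"
  have e': "(e has_field_derivative q z * e z) (at z)" if "z \<in> unit_disc" for z
    unfolding e_def by (rule derivative_eq_intros Q'[OF that] refl)+ simp
  have "e holomorphic_on unit_disc"
    using e' holomorphic_on_open open_ball by blast
  then obtain P where P: "\<And>z. z \<in> unit_disc \<Longrightarrow> (P has_field_derivative e z) (at z within unit_disc)"
    using holomorphic_convex_primitive'[OF convex_ball open_ball] by blast
  define f where "f = (\<lambda>z. P z - P 0)"
  have f': "(f has_field_derivative e z) (at z)" if "z \<in> unit_disc" for z
  proof -
    have "(P has_field_derivative e z) (at z)"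
      using P[OF that] that by (metis at_within_open open_ball)
    then show ?thesis
      unfolding f_def by (auto intro!: derivative_eq_intros)
  qed
  have df: "deriv f z = e z" if "z \<in> unit_disc" for z
    by (rule DERIV_imp_deriv[OF f'[OF that]])
  have ddf: "deriv (deriv f) z = q z * e z" if "z \<in> unit_disc" for z
    by (rule DERIV_imp_deriv, rule has_field_derivative_transform_within_open[OF e'[OF that], of unit_disc])
       (use that df in auto)
  show thesis
  proof
    have "f holomorphic_on unit_disc"
      using f' holomorphic_on_open open_ball by blast
    then show "f \<in> class_A"
      by (simp add: class_A_def df) (simp add: f_def e_def)
    show "deriv f z \<noteq> 0" if "z \<in> unit_disc" for z
      by (simp add: df[OF that] e_def)
    show "1 + z * deriv (deriv f) z / deriv f z = p z" if "z \<in> unit_disc" for z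
      using q(2)[of z] that by (simp add: df ddf e_def algebra_simps)
  qed
qed

section \<open>The coefficient estimate and its sharpness\<close>

theorem theorem7:
  fixes \<phi> :: "complex \<Rightarrow> complex"
  assumes "ma_minda \<phi>"
    and "mm_coeff \<phi> 1 \<le> \<bar>2 * (mm_coeff \<phi> 1)\<^sup>2 - mm_coeff \<phi> 2\<bar>"
  shows "(\<forall>f\<in>convex_class \<phi>.
            norm (T21 (local_inverse f))
              \<le> (mm_coeff \<phi> 1)\<^sup>2 / 4 + (2 * (mm_coeff \<phi> 1)\<^sup>2 - mm_coeff \<phi> 2)\<^sup>2 / 36)
       \<and> (\<exists>f\<in>convex_class \<phi>.
            norm (T21 (local_inverse f))
              = (mm_coeff \<phi> 1)\<^sup>2 / 4 + (2 * (mm_coeff \<phi> 1)\<^sup>2 - mm_coeff \<phi> 2)\<^sup>2 / 36)"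
proof (intro conjI ballI)
  define B where "B = mm_coeff \<phi> 1"
  define D where "D = 2 * (mm_coeff \<phi> 1)\<^sup>2 - mm_coeff \<phi> 2"
  have \<phi>: "\<phi> holomorphic_on unit_disc" "\<phi> 0 = 1" and "B > 0"
    using assms(1) by (auto simp: ma_minda_def B_def mm_coeff_def taylor_coeff_1)
  have BD: "B \<le> \<bar>D\<bar>"
    using assms(2) by (simp add: B_def D_def)
  {
    fix f assume f: "f \<in> convex_class \<phi>"
    obtain w where w: "w holomorphic_on unit_disc" "w 0 = 0"
      "\<And>z. z \<in> unit_disc \<Longrightarrow> norm (w z) \<le> 1"
      "\<forall>z\<in>unit_disc. 1 + z * deriv (deriv f) z / deriv f z = \<phi> (w z)"
      using f by (auto simp: convex_class_def subordinate_def)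
    define c\<^sub>1 where "c\<^sub>1 = taylor_coeff w 1"
    define c\<^sub>2 where "c\<^sub>2 = taylor_coeff w 2"
    have c: "norm c\<^sub>1 \<le> 1" "norm c\<^sub>2 \<le> 1 - (norm c\<^sub>1)\<^sup>2"
      using Schwarz_coeff_bounds[OF w(1-3)] by (auto simp: c\<^sub>1_def c\<^sub>2_def)
    have f': "f \<in> class_A" "\<forall>z\<in>unit_disc. deriv f z \<noteq> 0"
      using f by (auto simp: convex_class_def)
    note b = taylor_coeff_local_inverse_convex_class[OF assms(1) f' w(1,2,4),
        folded B_def D_def c\<^sub>1_def c\<^sub>2_def]
    have "norm (taylor_coeff (local_inverse f) 2) = B * norm c\<^sub>1 / 2"
      using \<open>B > 0\<close> by (simp add: b norm_mult norm_divide)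
    also have "\<dots> \<le> B / 2"
      using c(1) \<open>B > 0\<close> by simp
    finally have "(norm (taylor_coeff (local_inverse f) 2))\<^sup>2 \<le> (B / 2)\<^sup>2"
      by (intro power_mono) auto
    moreover have "norm (taylor_coeff (local_inverse f) 3) \<le> \<bar>D\<bar> / 6"
    proof -
      have "norm (of_real D * c\<^sub>1\<^sup>2 - of_real B * c\<^sub>2)
          \<le> norm (of_real D * c\<^sub>1\<^sup>2) + norm (of_real B * c\<^sub>2)"
        by (rule norm_triangle_ineq4)
      also have "\<dots> = \<bar>D\<bar> * (norm c\<^sub>1)\<^sup>2 + B * norm c\<^sub>2"
        using \<open>B > 0\<close> by (simp add: norm_mult norm_power)
      \<comment> \<open>Both assumptions on size enter here: \<open>B \<le> \<bar>D\<bar>\<close>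
        and the Schwarz-Pick bound on the second coefficient turn the sum into
        \<open>\<bar>D\<bar>\<close> times a convex combination of 1 with itself.\<close>
      also have "\<dots> \<le> \<bar>D\<bar> * (norm c\<^sub>1)\<^sup>2 + \<bar>D\<bar> * (1 - (norm c\<^sub>1)\<^sup>2)"
        using c BD by (intro add_left_mono mult_mono) auto
      also have "\<dots> = \<bar>D\<bar>"
        by (simp add: algebra_simps)
      finally show ?thesis
        by (simp add: b norm_divide)
    qed
    then have "(norm (taylor_coeff (local_inverse f) 3))\<^sup>2 \<le> (\<bar>D\<bar> / 6)\<^sup>2"
      by (intro power_mono) auto
    moreover have "norm (T21 (local_inverse f))
        \<le> (norm (taylor_coeff (local_inverse f) 2))\<^sup>2 + (norm (taylor_coeff (local_inverse f) 3))\<^sup>2"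
      unfolding T21_def norm_power[symmetric] by (rule norm_triangle_ineq4)
    ultimately have "norm (T21 (local_inverse f)) \<le> B\<^sup>2 / 4 + D\<^sup>2 / 36"
      by (simp add: power_divide)
    then show "norm (T21 (local_inverse f))
        \<le> (mm_coeff \<phi> 1)\<^sup>2 / 4 + (2 * (mm_coeff \<phi> 1)\<^sup>2 - mm_coeff \<phi> 2)\<^sup>2 / 36"
      by (simp add: B_def D_def)
  }
  define w :: "complex \<Rightarrow> complex" where "w = (\<lambda>z. \<i> * z)"
  have w: "w holomorphic_on unit_disc" "w 0 = 0"
    by (auto simp: w_def intro!: holomorphic_intros)
  have w_le: "norm (w z) < 1" if "z \<in> unit_disc" for z
    using that by (simp add: w_def norm_mult)
  have \<phi>w: "(\<lambda>z. \<phi> (w z)) holomorphic_on unit_disc"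
    using holomorphic_on_compose_gen[OF w(1) \<phi>(1)] w_le by (force simp: o_def)
  obtain f where f: "f \<in> class_A" "\<forall>z\<in>unit_disc. deriv f z \<noteq> 0"
    "\<forall>z\<in>unit_disc. 1 + z * deriv (deriv f) z / deriv f z = \<phi> (w z)"
    using class_A_with_convexity_quotient[OF \<phi>w] w(2) \<phi>(2) by metis
  \<comment> \<open>Subordination also asks that the quotient be holomorphic, which is inherited
    from \<open>\<phi> \<circ> w\<close>, with which it agrees on the disc.\<close>
  have "(\<lambda>z. 1 + z * deriv (deriv f) z / deriv f z) holomorphic_on unit_disc"
    by (rule holomorphic_transform[OF \<phi>w]) (use f(3) in simp)
  then have "subordinate (\<lambda>z. 1 + z * deriv (deriv f) z / deriv f z) \<phi>"
    unfolding subordinate_def using w w_le f(3) \<phi>(1) by (auto intro!: exI[of _ w] less_imp_le)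
  then have mem: "f \<in> convex_class \<phi>"
    using f by (simp add: convex_class_def)
  have "w has_fps_expansion fps_const \<i> * fps_X"
    unfolding w_def by (intro fps_expansion_intros)
  then have W: "fps_expansion w 0 = fps_const \<i> * fps_X"
    by (rule fps_expansion_eqI)
  have c: "taylor_coeff w 1 = \<i>" "taylor_coeff w 2 = 0"
    by (simp_all add: W)
  note b = taylor_coeff_local_inverse_convex_class[OF assms(1) f(1,2) w f(3),
      folded B_def D_def, unfolded c]
  \<comment> \<open>The coefficients are now \<open>b_2 = - \<i> B / 2\<close> and
    \<open>b_3 = - D / 6\<close>, so the two squares in \<open>T21\<close> add up with the same sign
    instead of cancelling.\<close>
  have "T21 (local_inverse f) = - of_real (B\<^sup>2 / 4 + D\<^sup>2 / 36)"
    unfolding T21_def b by (simp add: power_mult_distrib power_divide)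
  then have "norm (T21 (local_inverse f)) = \<bar>B\<^sup>2 / 4 + D\<^sup>2 / 36\<bar>"
    by (simp only: norm_minus_cancel norm_of_real)
  also have "\<dots> = (mm_coeff \<phi> 1)\<^sup>2 / 4 + (2 * (mm_coeff \<phi> 1)\<^sup>2 - mm_coeff \<phi> 2)\<^sup>2 / 36"
    by (simp add: B_def D_def)
  finally show "\<exists>f\<in>convex_class \<phi>. norm (T21 (local_inverse f))
      = (mm_coeff \<phi> 1)\<^sup>2 / 4 + (2 * (mm_coeff \<phi> 1)\<^sup>2 - mm_coeff \<phi> 2)\<^sup>2 / 36"
    using mem by blast
qed

end
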